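(* Let $(H,\langle\cdot,\cdot\rangle)$ be an inner product space over $\mathbb{K}$ ($\mathbb{K}=\mathbb{R}$ or $\mathbb{C}$), let $\{e_i\}_{i\in I}$ be a family of orthonormal vectors in $H$, $F$ a finite subset of $I$, $\phi_i,\Phi_i,\gamma_i,\Gamma_i\in\mathbb{K}$ for $i\in F$, and $x,y\in H$. Suppose that either $$\operatorname{Re}\left\langle \sum_{i\in F}\Phi_i e_i-x,\ x-\sum_{i\in F}\phi_i e_i\right\rangle\ge 0,\qquad \operatorname{Re}\left\langle \sum_{i\in F}\Gamma_i e_i-y,\ y-\sum_{i\in F}\gamma_i e_i\right\rangle\ge 0,$$ or, equivalently, $$\left\|x-\sum_{i\in F}\frac{\Phi_i+\phi_i}{2}e_i\right\|\le\frac12\left(\sum_{i\in F}|\Phi_i-\phi_i|^2\right)^{1/2},\qquad \left\|y-\sum_{i\in F}\frac{\Gamma_i+\gamma_i}{2}e_i\right\|\le\frac12\left(\sum_{i\in F}|\Gamma_i-\gamma_i|^2\right)^{1/2}$$ hold (these two pairs of conditions are equivalent). Then $$\begin{aligned}0&\le\left|\langle x,y\rangle-\sum_{i\in F}\langle x,e_i\rangle\langle e_i,y\rangle\right|\\&\le\frac14\left(\sum_{i\in F}|\Phi_i-\phi_i|^2\right)^{1/2}\left(\sum_{i\in F}|\Gamma_i-\gamma_i|^2\right)^{1/2}-\sum_{i\in F}\left|\frac{\Phi_i+\phi_i}{2}-\langle x,e_i\rangle\right|\left|\frac{\Gamma_i+\gamma_i}{2}-\langle y,e_i\rangle\right|\\&\le\frac14\left(\sum_{i\in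 F}|\Phi_i-\phi_i|^2\right)^{1/2}\left(\sum_{i\in F}|\Gamma_i-\gamma_i|^2\right)^{1/2}.\end{aligned}$$ The constant $\frac14$ is best possible: for every real $c<\frac14$, neither the bound $$\left|\langle x,y\rangle-\sum_{i\in F}\langle x,e_i\rangle\langle e_i,y\rangle\right|\le c\left(\sum_{i\in F}|\Phi_i-\phi_i|^2\right)^{1/2}\left(\sum_{i\in F}|\Gamma_i-\gamma_i|^2\right)^{1/2}-\sum_{i\in F}\left|\frac{\Phi_i+\phi_i}{2}-\langle x,e_i\rangle\right|\left|\frac{\Gamma_i+\gamma_i}{2}-\langle y,e_i\rangle\right|$$ nor the bound $$\left|\langle x,y\rangle-\sum_{i\in F}\langle x,e_i\rangle\langle e_i,y\rangle\right|\le c\left(\sum_{i\in F}|\Phi_i-\phi_i|^2\right)^{1/2}\left(\sum_{i\in F}|\Gamma_i-\gamma_i|^2\right)^{1/2}$$ holds for all choices of an inner product space $H$ over $\mathbb{K}$, a family $\{e_i\}_{i\in I}$ of orthonormal vectors in $H$, a finite subset $F$ of $I$, scalars $\phi_i,\Phi_i,\gamma_i,\Gamma_i\in\mathbb{K}$ ($i\in F$) and vectors $x,y\in H$ satisfying $\operatorname{Re}\left\langle \sum_{i\in F}\Phi_i e_i-x,\ x-\sum_{i\in F}\phi_i e_i\right\rangle\ge 0$ and $\operatorname{Re}\left\langle \sum_{i\in F}\Gamma_i e_i-y,\ y-\sum_{i\in F}\gamma_i e_i\right\rangle\ge 0$.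
   Context: The inner product is linear in the first argument and conjugate-linear in the second; $\|x\|=\langle x,x\rangle^{1/2}$. $H$ is not assumed complete. *)

theory Defs
  imports Complex_Main "HOL-Library.Product_Plus"
begin

text \<open>
  The scalar fields \<open>\<real>\<close> and \<open>\<complex>\<close>, treated uniformly. The axioms determine conjugation and real
  part from the norm, and they admit no other fields: see \<open>real_or_complex_cases\<close> below.
\<close>

class real_or_complex = real_normed_field +
  fixes conjugate :: "'a \<Rightarrow> 'a"
    and real_part :: "'a \<Rightarrow> real"
  assumes conjugate_add: "conjugate (a + b) = conjugate a + conjugate b"
    and mult_conjugate_scaleR: "a * conjugate a = (norm a)\<^sup>2 *\<^sub>R 1"
    and add_conjugate_scaleR: "a + conjugate a = (2 * real_part a) *\<^sub>R 1"

instantiation real :: real_or_complex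
begin

definition conjugate_real :: "real \<Rightarrow> real" where
  "conjugate_real a = a"

definition real_part_real :: "real \<Rightarrow> real" where
  "real_part_real a = a"

instance
  by standard (simp_all add: conjugate_real_def real_part_real_def power2_eq_square)

end

instantiation complex :: real_or_complex
begin

definition conjugate_complex :: "complex \<Rightarrow> complex" where
  "conjugate_complex = cnj"

definition real_part_complex :: "complex \<Rightarrow> real" where
  "real_part_complex = Re"

instance
proof
  fix a b :: complex
  show "conjugate (a + b) = conjugate a + conjugate b"
    by (simp add: conjugate_complex_def)
  show "a * conjugate a = (norm a)\<^sup>2 *\<^sub>R 1"
    unfolding conjugate_complex_def of_real_def[symmetric] by (rule complex_norm_square[symmetric])
  show "a + conjugate a = (2 * real_part a) *\<^sub>R 1"
    unfolding conjugate_complex_def real_part_complex_def of_real_def[symmetric]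
    by (rule complex_add_cnj)
qed

end

lemma mult_conjugate: "a * conjugate a = of_real ((norm (a::'k::real_or_complex))\<^sup>2)"
  by (simp add: of_real_def mult_conjugate_scaleR)

lemma add_conjugate: "a + conjugate a = of_real (2 * real_part (a::'k::real_or_complex))"
  by (simp add: of_real_def add_conjugate_scaleR)

lemma conjugate_zero [simp]: "conjugate (0::'k::real_or_complex) = 0"
  using conjugate_add[of "0::'k" 0] by simp

lemma conjugate_minus [simp]: "conjugate (- a) = - conjugate (a::'k::real_or_complex)"
  using conjugate_add[of a "- a"] by (simp add: eq_neg_iff_add_eq_0 add.commute)

lemma conjugate_diff: "conjugate (a - b) = conjugate a - conjugate (b::'k::real_or_complex)"
  using conjugate_add[of a "- b"] by simp

lemma norm_conjugate [simp]: "norm (conjugate a) = norm (a::'k::real_or_complex)"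
proof (cases "a = 0")
  case False
  have "norm a * norm (conjugate a) = (norm a)\<^sup>2"
    unfolding norm_mult[symmetric] mult_conjugate by (simp add: norm_power)
  with False show ?thesis by (simp add: power2_eq_square)
qed simp

lemma conjugate_conjugate [simp]: "conjugate (conjugate a) = (a::'k::real_or_complex)"
proof (cases "a = 0")
  case False
  have "conjugate a * conjugate (conjugate a) = conjugate a * a"
    using mult_conjugate[of "conjugate a"] mult_conjugate[of a] by (simp add: mult.commute)
  moreover have "conjugate a \<noteq> 0"
    using False norm_conjugate[of a] by (metis norm_eq_zero)
  ultimately show ?thesis by simp
qed simp

lemma conjugate_mult: "conjugate (a * b) = conjugate a * conjugate (b::'k::real_or_complex)"
proof (cases "a * b = 0")
  case False
  have "(a * b) * conjugate (a * b) = (a * conjugate a) * (b * conjugate b)"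
    unfolding mult_conjugate by (simp add: norm_mult power_mult_distrib)
  then have "(a * b) * conjugate (a * b) = (a * b) * (conjugate a * conjugate b)"
    by (simp add: ac_simps)
  with False show ?thesis by (metis mult_left_cancel)
qed auto

lemma conjugate_fixed:
  assumes "conjugate (a::'k::real_or_complex) = a"
  shows "a = of_real (real_part a)"
  using add_conjugate[of a] assms by simp

lemma real_or_complex_cases:
  "(\<forall>z::'k::real_or_complex. z = of_real (real_part z)) \<or>
   (\<exists>u::'k. u * u = - 1 \<and> (\<forall>z. \<exists>a b. z = of_real a + of_real b * u))"
proof (cases "\<forall>z::'k. conjugate z = z")
  case True
  then show ?thesis using conjugate_fixed by blast
next
  case False
  then obtain z0 :: 'k where z0: "conjugate z0 \<noteq> z0" by blast
  define w where "w = z0 - conjugate z0"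
  have w0: "norm w \<noteq> 0" using z0 by (simp add: w_def)
  have cw: "conjugate w = - w" by (simp add: w_def conjugate_diff)
  have ww: "w * w = - of_real ((norm w)\<^sup>2)"
    using mult_conjugate[of w] cw by (metis minus_minus mult_minus_right)
  define u where "u = w / of_real (norm w)"
  have uu: "u * u = - 1"
    using w0 ww by (simp add: u_def power2_eq_square field_simps)
  have wu: "w = of_real (norm w) * u" using w0 by (simp add: u_def)
  have "\<exists>a b. z = of_real a + of_real b * u" for z :: 'k
  proof -
    define d where "d = z - conjugate z"
    have cd: "conjugate d = - d" by (simp add: d_def conjugate_diff)
    have "conjugate (d * w) = d * w" by (simp add: conjugate_mult cd cw)
    then have "d * w = of_real (real_part (d * w))" by (rule conjugate_fixed)
    then obtain r where "d * w = of_real r" by blast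
    then have "d * (w * w) = of_real r * w" by (simp add: ac_simps)
    then have "d * of_real ((norm w)\<^sup>2) = - (of_real r * w)"
      unfolding ww by (metis minus_minus mult_minus_right)
    also have "\<dots> = - (of_real r * (of_real (norm w) * u))"
      by (simp only: wu[symmetric])
    also have "\<dots> = of_real (- (r * norm w)) * u"
      by simp
    also have "- (r * norm w) = - r / norm w * (norm w)\<^sup>2"
      using w0 by (simp add: power2_eq_square)
    finally have "d * of_real ((norm w)\<^sup>2) =
        (of_real (- r / norm w) * u) * of_real ((norm w)\<^sup>2)"
      by (simp only: of_real_mult ac_simps)
    then have d: "d = of_real (- r / norm w) * u"
      using w0 by (metis mult_right_cancel of_real_eq_0_iff power_not_zero)
    have "2 * z = of_real (2 * real_part z) + d"
      using add_conjugate[of z] by (simp add: d_def algebra_simps)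
    then have "z = of_real (real_part z) + d / 2" by (simp add: field_simps)
    also have "d / 2 = of_real (- r / norm w / 2) * u" by (simp add: d)
    finally show ?thesis by blast
  qed
  with uu show ?thesis by blast
qed

locale inner_product_space = vector_space scale
  for scale :: "'k::real_or_complex \<Rightarrow> 'v::ab_group_add \<Rightarrow> 'v" +
  fixes ip :: "'v \<Rightarrow> 'v \<Rightarrow> 'k"
  assumes ip_add_left: "ip (x + y) z = ip x z + ip y z"
    and ip_scale_left: "ip (scale a x) y = a * ip x y"
    and ip_commute: "ip y x = conjugate (ip x y)"
    and ip_ge_zero: "0 \<le> real_part (ip x x)"
    and ip_eq_zero: "ip x x = 0 \<Longrightarrow> x = 0"

definition ip_norm :: "('v \<Rightarrow> 'v \<Rightarrow> 'k::real_or_complex) \<Rightarrow> 'v \<Rightarrow> real" where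
  "ip_norm ip x = sqrt (real_part (ip x x))"

definition orthonormal_family ::
  "('v \<Rightarrow> 'v \<Rightarrow> 'k::real_or_complex) \<Rightarrow> 'i set \<Rightarrow> ('i \<Rightarrow> 'v) \<Rightarrow> bool" where
  "orthonormal_family ip I e \<longleftrightarrow>
    (\<forall>i\<in>I. \<forall>j\<in>I. ip (e i) (e j) = (if i = j then 1 else 0))"

end

theory Submission
  imports Defs "HOL-Analysis.L2_Norm"
begin

text \<open>
  Put \<open>D = \<Sum>i\<in>F. ((\<Phi> i - \<phi> i) / 2) e i\<close> and let \<open>u\<close> be the difference of \<open>x\<close> and the midpoint
  \<open>\<Sum>i\<in>F. ((\<Phi> i + \<phi> i) / 2) e i\<close>. Since \<open>Re \<langle>D - u, D + u\<rangle> = \<parallel>D\<parallel>\<^sup>2 - \<parallel>u\<parallel>\<^sup>2\<close>, the two forms of the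
  hypothesis agree. If \<open>x'\<close> and \<open>y'\<close> are the components of \<open>x\<close> and \<open>y\<close> orthogonal to the \<open>e i\<close>, the
  quantity to be estimated is \<open>\<langle>x', y'\<rangle>\<close>, and Pythagoras turns the hypotheses into
  \<open>\<parallel>x'\<parallel>\<^sup>2 + (\<Sum>i\<in>F. \<bar>(\<Phi> i + \<phi> i) / 2 - \<langle>x, e i\<rangle>\<bar>\<^sup>2) \<le> (\<Sum>i\<in>F. \<bar>\<Phi> i - \<phi> i\<bar>\<^sup>2) / 4\<close> and its analogue for \<open>y\<close>.
  Cauchy-Schwarz in \<open>H\<close>, in \<open>\<real>\<^sup>F\<close> and in \<open>\<real>\<^sup>2\<close> gives the bound.
  Equality holds for one vector \<open>e\<close>, bounds \<open>\<plusminus>1\<close>, and \<open>x = y\<close> a unit vector orthogonal to \<open>e\<close>.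
\<close>

section \<open>Real part and conjugation of scalars\<close>

text \<open>The axioms give access to \<open>real_part\<close> only through
  \<open>a + conjugate a\<close>; injectivity of \<open>of_real\<close> turns that sum into a
  criterion from which the rules below follow.\<close>

lemma real_part_eqI:
  assumes "a + conjugate a = of_real (2 * r)"
  shows "real_part (a::'k::real_or_complex) = r"
proof -
  have "(of_real (2 * real_part a) :: 'k) = of_real (2 * r)"
    using assms add_conjugate[of a] by simp
  then show ?thesis by (simp only: of_real_eq_iff)
qed

lemma real_part_add: "real_part (a + b) = real_part a + real_part (b::'k::real_or_complex)"
  using add_conjugate[of a] add_conjugate[of b]
  by (intro real_part_eqI) (simp add: conjugate_add algebra_simps)

lemma real_part_minus [simp]: "real_part (- a) = - real_part (a::'k::real_or_complex)"
proof (rule real_part_eqI)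
  have "- a + conjugate (- a) = - (a + conjugate a)" by simp
  then show "- a + conjugate (- a) = of_real (2 * - real_part a)"
    unfolding add_conjugate by simp
qed

lemma real_part_diff: "real_part (a - b) = real_part a - real_part (b::'k::real_or_complex)"
  using real_part_add[of a "- b"] by simp

lemma real_part_conjugate [simp]:
  "real_part (conjugate a) = real_part (a::'k::real_or_complex)"
  using add_conjugate[of a] by (intro real_part_eqI) (simp add: add.commute)

lemma conjugate_one [simp]: "conjugate (1::'k::real_or_complex) = 1"
  using mult_conjugate[of "1::'k"] by simp

text \<open>The norm axiom at a real number \<open>r\<close> gives
  \<open>r * conjugate r = r * r\<close>; cancelling a nonzero \<open>r\<close> shows that reals are
  their own conjugates.\<close>

lemma real_part_of_real [simp]: "real_part (of_real r :: 'k::real_or_complex) = r"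
proof (cases "r = 0")
  case False
  have "of_real r * conjugate (of_real r :: 'k) = of_real r * of_real r"
    using mult_conjugate[of "of_real r :: 'k"] by (simp add: power2_eq_square)
  with False have "conjugate (of_real r :: 'k) = of_real r" by simp
  then show ?thesis by (intro real_part_eqI) simp
qed (simp add: real_part_eqI)

lemma real_part_zero [simp]: "real_part (0::'k::real_or_complex) = 0"
  using real_part_of_real[of 0, where ?'k = 'k] by simp

text \<open>Lagrange's identity for the plane vectors \<open>(p, a)\<close> and
  \<open>(q, b)\<close>, whose lengths are at most \<open>r\<close> and \<open>s\<close>.\<close>

lemma Cauchy_Schwarz_real2:
  fixes a b p q r s :: real
  assumes "p\<^sup>2 + a\<^sup>2 \<le> r\<^sup>2" "q\<^sup>2 + b\<^sup>2 \<le> s\<^sup>2" "0 \<le> r" "0 \<le> s"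
  shows "p * q + a * b \<le> r * s"
proof (rule power2_le_imp_le)
  have "(p * q + a * b)\<^sup>2 + (p * b - a * q)\<^sup>2 = (p\<^sup>2 + a\<^sup>2) * (q\<^sup>2 + b\<^sup>2)"
    by (simp add: power2_eq_square algebra_simps)
  moreover have "\<dots> \<le> r\<^sup>2 * s\<^sup>2"
    using assms by (intro mult_mono) auto
  ultimately show "(p * q + a * b)\<^sup>2 \<le> (r * s)\<^sup>2"
    using zero_le_power2[of "p * b - a * q"] unfolding power_mult_distrib by linarith
qed (use assms in simp)

section \<open>Inner product calculus and Cauchy-Schwarz\<close>

context inner_product_space
begin

lemma ip_add_right: "ip x (y + z) = ip x y + ip x z"
  by (metis ip_add_left ip_commute conjugate_add)

lemma ip_scale_right: "ip x (scale a y) = conjugate a * ip x y"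
  by (metis ip_scale_left ip_commute conjugate_mult)

lemma ip_zero_left [simp]: "ip 0 x = 0"
  using ip_add_left[of 0 0 x] by simp

lemma ip_zero_right [simp]: "ip x 0 = 0"
  using ip_add_right[of x 0 0] by simp

lemma ip_minus_left [simp]: "ip (- x) y = - ip x y"
  using ip_add_left[of x "- x" y] by (simp add: eq_neg_iff_add_eq_0 add.commute)

lemma ip_minus_right [simp]: "ip x (- y) = - ip x y"
  using ip_add_right[of x y "- y"] by (simp add: eq_neg_iff_add_eq_0 add.commute)

lemma ip_diff_left: "ip (x - y) z = ip x z - ip y z"
  using ip_add_left[of x "- y" z] by simp

lemma ip_diff_right: "ip x (y - z) = ip x y - ip x z"
  using ip_add_right[of x y "- z"] by simp

lemma ip_sum_left: "ip (\<Sum>i\<in>A. f i) y = (\<Sum>i\<in>A. ip (f i) y)"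
  by (induction A rule: infinite_finite_induct) (simp_all add: ip_add_left)

lemma ip_sum_right: "ip x (\<Sum>i\<in>A. f i) = (\<Sum>i\<in>A. ip x (f i))"
  by (induction A rule: infinite_finite_induct) (simp_all add: ip_add_right)

lemma ip_norm_nonneg: "0 \<le> ip_norm ip x"
  by (simp add: ip_norm_def ip_ge_zero)

lemma ip_norm_square: "(ip_norm ip x)\<^sup>2 = real_part (ip x x)"
  by (simp add: ip_norm_def ip_ge_zero)

lemma ip_self: "ip x x = of_real ((ip_norm ip x)\<^sup>2)"
  unfolding ip_norm_square by (rule conjugate_fixed) (metis ip_commute)

lemma ip_norm_add_square:
  assumes "ip x y = 0"
  shows "(ip_norm ip (x + y))\<^sup>2 = (ip_norm ip x)\<^sup>2 + (ip_norm ip y)\<^sup>2"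
  using assms ip_commute[of y x]
  by (simp add: ip_norm_square ip_add_left ip_add_right real_part_add)

lemma Cauchy_Schwarz: "norm (ip x y) \<le> ip_norm ip x * ip_norm ip y"
proof (cases "y = 0")
  case True
  then show ?thesis by (simp add: ip_norm_def)
next
  case False
  define n where "n = (ip_norm ip y)\<^sup>2"
  have yy: "ip y y = of_real n" by (simp add: n_def ip_self)
  then have n0: "n \<noteq> 0" using False ip_eq_zero[of y] by auto
  then have n: "0 < n" unfolding n_def by simp
  \<comment> \<open>The residual of \<open>x\<close> after projection onto \<open>y\<close>. It is
    orthogonal to \<open>y\<close>, and nonnegativity of \<open>ip w w\<close> is the claim divided
    by \<open>n\<close>.\<close>
  define w where "w = x - scale (ip x y / of_real n) y"
  have wy: "ip w y = 0" using n0 by (simp add: w_def ip_diff_left ip_scale_left yy)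
  have "ip w w = ip w x"
    by (subst (2) w_def) (simp add: ip_diff_right ip_scale_right wy)
  also have "\<dots> = ip x x - ip x y * conjugate (ip x y) / of_real n"
    by (simp add: w_def ip_diff_left ip_scale_left ip_commute[of y x])
  also have "\<dots> = of_real ((ip_norm ip x)\<^sup>2 - (norm (ip x y))\<^sup>2 / n)"
    unfolding mult_conjugate ip_self by simp
  finally have "(norm (ip x y))\<^sup>2 / n \<le> (ip_norm ip x)\<^sup>2"
    using ip_ge_zero[of w] by (simp only: real_part_of_real)
  then have "(norm (ip x y))\<^sup>2 \<le> (ip_norm ip x * ip_norm ip y)\<^sup>2"
    using n by (simp add: n_def power_mult_distrib pos_divide_le_eq)
  then show ?thesis
    by (rule power2_le_imp_le) (simp add: ip_norm_nonneg)
qed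

section \<open>Expansions in a finite orthonormal family\<close>

lemma orthonormal_ip_sum:
  assumes "orthonormal_family ip I e" "finite F" "F \<subseteq> I" "j \<in> F"
  shows "ip (\<Sum>i\<in>F. scale (a i) (e i)) (e j) = a j"
proof -
  have "ip (\<Sum>i\<in>F. scale (a i) (e i)) (e j) = (\<Sum>i\<in>F. a i * ip (e i) (e j))"
    by (simp add: ip_sum_left ip_scale_left)
  also have "\<dots> = (\<Sum>i\<in>F. if i = j then a i else 0)"
    using assms by (intro sum.cong) (auto simp: orthonormal_family_def subset_iff)
  finally show ?thesis using assms by simp
qed

lemma orthogonal_component:
  assumes "orthonormal_family ip I e" "finite F" "F \<subseteq> I" "j \<in> F"
  shows "ip (x - (\<Sum>i\<in>F. scale (ip x (e i)) (e i))) (e j) = 0"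
  using orthonormal_ip_sum[OF assms] by (simp add: ip_diff_left)

text \<open>Finite Parseval identity: pairing the sum with \<open>e j\<close> reads off the
  coefficient \<open>a j\<close>.\<close>

lemma ip_norm_orthonormal_sum:
  assumes "orthonormal_family ip I e" "finite F" "F \<subseteq> I"
  shows "(ip_norm ip (\<Sum>i\<in>F. scale (a i) (e i)))\<^sup>2 = (\<Sum>i\<in>F. (norm (a i))\<^sup>2)"
proof -
  let ?s = "\<Sum>i\<in>F. scale (a i) (e i)"
  have "ip ?s ?s = (\<Sum>j\<in>F. conjugate (a j) * ip ?s (e j))"
    by (subst ip_sum_right) (simp add: ip_scale_right)
  also have "\<dots> = (\<Sum>j\<in>F. a j * conjugate (a j))"
    using orthonormal_ip_sum[OF assms] by (intro sum.cong) (simp_all add: mult.commute)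
  also have "\<dots> = of_real (\<Sum>i\<in>F. (norm (a i))\<^sup>2)"
    by (simp add: mult_conjugate)
  finally show ?thesis
    unfolding ip_norm_square by (simp only: real_part_of_real)
qed

lemma real_part_bounds_iff_ball:
  assumes "orthonormal_family ip I e" "finite F" "F \<subseteq> I"
  shows "0 \<le> real_part (ip ((\<Sum>i\<in>F. scale (\<Phi> i) (e i)) - x) (x - (\<Sum>i\<in>F. scale (\<phi> i) (e i)))) \<longleftrightarrow>
    ip_norm ip (x - (\<Sum>i\<in>F. scale ((\<Phi> i + \<phi> i) / 2) (e i)))
      \<le> 1 / 2 * sqrt (\<Sum>i\<in>F. (norm (\<Phi> i - \<phi> i))\<^sup>2)"
proof -
  define d where "d = (\<Sum>i\<in>F. scale ((\<Phi> i - \<phi> i) / 2) (e i))"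
  define u where "u = x - (\<Sum>i\<in>F. scale ((\<Phi> i + \<phi> i) / 2) (e i))"
  define R where "R = 1 / 2 * sqrt (\<Sum>i\<in>F. (norm (\<Phi> i - \<phi> i))\<^sup>2)"
  have R: "0 \<le> R" by (simp add: R_def sum_nonneg)
  have "(ip_norm ip d)\<^sup>2 = (\<Sum>i\<in>F. (norm ((\<Phi> i - \<phi> i) / 2))\<^sup>2)"
    unfolding d_def by (rule ip_norm_orthonormal_sum[OF assms])
  also have "\<dots> = R\<^sup>2"
    by (simp add: R_def power_mult_distrib power_divide norm_divide sum_nonneg
        flip: sum_divide_distrib)
  finally have d: "(ip_norm ip d)\<^sup>2 = R\<^sup>2" .
  \<comment> \<open>Coefficientwise, half-difference plus midpoint is the upper bound, and lower
    bound plus half-difference is the midpoint.\<close>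
  have halves: "(a - b) / 2 + (a + b) / 2 = a" "b + (a - b) / 2 = (a + b) / 2" for a b :: 'k
    by (simp_all add: field_simps)
  have "(\<Sum>i\<in>F. scale (\<Phi> i) (e i)) - x = d - u"
    unfolding d_def u_def
    by (simp add: halves algebra_simps flip: sum.distrib scale_left_distrib)
  moreover have "x - (\<Sum>i\<in>F. scale (\<phi> i) (e i)) = d + u"
    unfolding d_def u_def
    by (simp add: halves algebra_simps flip: sum.distrib scale_left_distrib)
  \<comment> \<open>The cross terms \<open>ip d u\<close> and \<open>ip u d\<close> are conjugate,
    so their real parts cancel.\<close>
  moreover have "real_part (ip (d - u) (d + u)) = R\<^sup>2 - (ip_norm ip u)\<^sup>2"
    using ip_commute[of u d] d
    by (simp add: ip_diff_left ip_add_right real_part_diff real_part_add ip_norm_square)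
  ultimately show ?thesis
    unfolding u_def[symmetric] R_def[symmetric]
    using R ip_norm_nonneg[of u] by (simp add: power_mono_iff)
qed

text \<open>The difference splits into \<open>x'\<close>, orthogonal to every \<open>e i\<close>
  with \<open>i\<close> in \<open>F\<close>, and \<open>v\<close>, in their span. With midpoints for
  \<open>m\<close>, a ball condition then bounds both parts at once.\<close>

lemma Pythagoras_orthonormal:
  assumes "orthonormal_family ip I e" "finite F" "F \<subseteq> I"
  shows "(ip_norm ip (x - (\<Sum>i\<in>F. scale (m i) (e i))))\<^sup>2 =
    (ip_norm ip (x - (\<Sum>i\<in>F. scale (ip x (e i)) (e i))))\<^sup>2 + (\<Sum>i\<in>F. (norm (m i - ip x (e i)))\<^sup>2)"
proof -
  define x' where "x' = x - (\<Sum>i\<in>F. scale (ip x (e i)) (e i))"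
  define v where "v = (\<Sum>i\<in>F. scale (ip x (e i) - m i) (e i))"
  have "ip x' (e i) = 0" if "i \<in> F" for i
    unfolding x'_def by (rule orthogonal_component[OF assms that])
  then have "ip x' v = 0"
    by (simp add: v_def ip_sum_right ip_scale_right)
  moreover have "x - (\<Sum>i\<in>F. scale (m i) (e i)) = x' + v"
    by (simp add: x'_def v_def scale_left_diff_distrib sum_subtractf)
  moreover have "(ip_norm ip v)\<^sup>2 = (\<Sum>i\<in>F. (norm (m i - ip x (e i)))\<^sup>2)"
    unfolding v_def by (simp add: ip_norm_orthonormal_sum[OF assms] norm_minus_commute)
  ultimately show ?thesis
    using ip_norm_add_square[of x' v] by (simp only: flip: x'_def)
qed

text \<open>The first argument is orthogonal to the sum subtracted from \<open>y\<close>, so that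
  sum drops out.\<close>

lemma ip_orthogonal_components:
  assumes "orthonormal_family ip I e" "finite F" "F \<subseteq> I"
  shows "ip (x - (\<Sum>i\<in>F. scale (ip x (e i)) (e i))) (y - (\<Sum>i\<in>F. scale (ip y (e i)) (e i))) =
    ip x y - (\<Sum>i\<in>F. ip x (e i) * ip (e i) y)"
proof -
  define x' where "x' = x - (\<Sum>i\<in>F. scale (ip x (e i)) (e i))"
  have "ip x' (e i) = 0" if "i \<in> F" for i
    unfolding x'_def by (rule orthogonal_component[OF assms that])
  then have "ip x' (y - (\<Sum>i\<in>F. scale (ip y (e i)) (e i))) = ip x' y"
    by (simp add: ip_diff_right ip_sum_right ip_scale_right)
  then show ?thesis
    by (simp add: x'_def ip_diff_left ip_sum_left ip_scale_left)
qed

section \<open>The Gruss estimate\<close>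

text \<open>Centres and radii are arbitrary here. The theorem takes midpoints as centres and half
  the root sums as radii, so \<open>r * s\<close> produces the factor 1/4.\<close>

lemma Gruss_inequality:
  assumes on: "orthonormal_family ip I e" "finite F" "F \<subseteq> I"
    and x: "ip_norm ip (x - (\<Sum>i\<in>F. scale (m i) (e i))) \<le> r"
    and y: "ip_norm ip (y - (\<Sum>i\<in>F. scale (n i) (e i))) \<le> s"
  shows "norm (ip x y - (\<Sum>i\<in>F. ip x (e i) * ip (e i) y))
    \<le> r * s - (\<Sum>i\<in>F. norm (m i - ip x (e i)) * norm (n i - ip y (e i)))"
proof -
  define x' y' where "x' = x - (\<Sum>i\<in>F. scale (ip x (e i)) (e i))"
    and "y' = y - (\<Sum>i\<in>F. scale (ip y (e i)) (e i))"
  define a b where "a = L2_set (\<lambda>i. norm (m i - ip x (e i))) F"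
    and "b = L2_set (\<lambda>i. norm (n i - ip y (e i))) F"
  have rs: "0 \<le> r" "0 \<le> s"
    using x y ip_norm_nonneg order_trans by blast+
  have "(ip_norm ip x')\<^sup>2 + a\<^sup>2 \<le> r\<^sup>2"
    using power_mono[OF x ip_norm_nonneg, of 2] Pythagoras_orthonormal[OF on, of x m]
    by (simp add: x'_def a_def L2_set_def sum_nonneg)
  moreover have "(ip_norm ip y')\<^sup>2 + b\<^sup>2 \<le> s\<^sup>2"
    using power_mono[OF y ip_norm_nonneg, of 2] Pythagoras_orthonormal[OF on, of y n]
    by (simp add: y'_def b_def L2_set_def sum_nonneg)
  \<comment> \<open>Cauchy-Schwarz three times: here in the plane, next for the coefficient
    deviations over \<open>F\<close>, then for \<open>x'\<close> and \<open>y'\<close> in the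
    space.\<close>
  ultimately have "ip_norm ip x' * ip_norm ip y' + a * b \<le> r * s"
    using rs by (rule Cauchy_Schwarz_real2)
  moreover have "(\<Sum>i\<in>F. norm (m i - ip x (e i)) * norm (n i - ip y (e i))) \<le> a * b"
    using L2_set_mult_ineq[of "\<lambda>i. norm (m i - ip x (e i))" "\<lambda>i. norm (n i - ip y (e i))" F]
    by (simp add: a_def b_def)
  moreover have "norm (ip x y - (\<Sum>i\<in>F. ip x (e i) * ip (e i) y)) \<le> ip_norm ip x' * ip_norm ip y'"
    using Cauchy_Schwarz[of x' y'] ip_orthogonal_components[OF on, of x y]
    by (simp add: x'_def y'_def)
  ultimately show ?thesis by linarith
qed

end

section \<open>Sharpness of the constant\<close>

text \<open>With \<open>pair_ip\<close> this is the standard two-dimensional inner product space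
  over \<open>'k\<close>: one direction carries the orthonormal family, the other is orthogonal to
  it.\<close>

definition pair_scale :: "'k::real_or_complex \<Rightarrow> 'k \<times> 'k \<Rightarrow> 'k \<times> 'k" where
  "pair_scale a v = (a * fst v, a * snd v)"

definition pair_ip :: "'k::real_or_complex \<times> 'k \<Rightarrow> 'k \<times> 'k \<Rightarrow> 'k" where
  "pair_ip v w = fst v * conjugate (fst w) + snd v * conjugate (snd w)"

lemma pair_ip_self:
  "pair_ip v v = of_real ((norm (fst v))\<^sup>2 + (norm (snd (v::'k::real_or_complex \<times> 'k)))\<^sup>2)"
  by (simp add: pair_ip_def mult_conjugate)

lemma inner_product_space_pair:
  "inner_product_space pair_scale (pair_ip :: 'k::real_or_complex \<times> 'k \<Rightarrow> _)"
proof
  fix v w z :: "'k \<times> 'k" and a b :: 'k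
  show "pair_scale a (v + w) = pair_scale a v + pair_scale a w"
    "pair_scale (a + b) v = pair_scale a v + pair_scale b v"
    "pair_scale a (pair_scale b v) = pair_scale (a * b) v"
    "pair_scale 1 v = v"
    by (simp_all add: pair_scale_def prod_eq_iff algebra_simps)
  show "pair_ip (v + w) z = pair_ip v z + pair_ip w z"
    "pair_ip (pair_scale a v) w = a * pair_ip v w"
    "pair_ip w v = conjugate (pair_ip v w)"
    by (simp_all add: pair_ip_def pair_scale_def conjugate_add conjugate_mult algebra_simps)
  show "0 \<le> real_part (pair_ip v v)"
    unfolding pair_ip_self real_part_of_real by simp
  show "v = 0" if "pair_ip v v = 0"
    using that unfolding pair_ip_self of_real_eq_0_iff sum_power2_eq_zero_iff
    by (simp add: prod_eq_iff)
qed

(* A space on which a bound fails is exhibited on the additive group K * K, indexed by nat: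
   HOL cannot quantify over the underlying type of the space inside a formula. *)
theorem theorem4:
  "(\<forall>(scale :: 'k::real_or_complex \<Rightarrow> 'v::ab_group_add \<Rightarrow> 'v) ip (I :: 'i set) e F \<phi> \<Phi> \<gamma> \<Gamma> x y.
      inner_product_space scale ip \<and> orthonormal_family ip I e \<and> finite F \<and> F \<subseteq> I \<longrightarrow>
      (0 \<le> real_part (ip ((\<Sum>i\<in>F. scale (\<Phi> i) (e i)) - x) (x - (\<Sum>i\<in>F. scale (\<phi> i) (e i)))) \<and>
       0 \<le> real_part (ip ((\<Sum>i\<in>F. scale (\<Gamma> i) (e i)) - y) (y - (\<Sum>i\<in>F. scale (\<gamma> i) (e i))))
       \<longleftrightarrow>
       ip_norm ip (x - (\<Sum>i\<in>F. scale ((\<Phi> i + \<phi> i) / 2) (e i))) \<le> 1 / 2 * sqrt (\<Sum>i\<in>F. (norm (\<Phi> i - \<phi> i))\<^sup>2) \<and>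
       ip_norm ip (y - (\<Sum>i\<in>F. scale ((\<Gamma> i + \<gamma> i) / 2) (e i))) \<le> 1 / 2 * sqrt (\<Sum>i\<in>F. (norm (\<Gamma> i - \<gamma> i))\<^sup>2)) \<and>
      ((0 \<le> real_part (ip ((\<Sum>i\<in>F. scale (\<Phi> i) (e i)) - x) (x - (\<Sum>i\<in>F. scale (\<phi> i) (e i)))) \<and>
        0 \<le> real_part (ip ((\<Sum>i\<in>F. scale (\<Gamma> i) (e i)) - y) (y - (\<Sum>i\<in>F. scale (\<gamma> i) (e i))))) \<or>
       (ip_norm ip (x - (\<Sum>i\<in>F. scale ((\<Phi> i + \<phi> i) / 2) (e i))) \<le> 1 / 2 * sqrt (\<Sum>i\<in>F. (norm (\<Phi> i - \<phi> i))\<^sup>2) \<and>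
        ip_norm ip (y - (\<Sum>i\<in>F. scale ((\<Gamma> i + \<gamma> i) / 2) (e i))) \<le> 1 / 2 * sqrt (\<Sum>i\<in>F. (norm (\<Gamma> i - \<gamma> i))\<^sup>2))
       \<longrightarrow>
       0 \<le> norm (ip x y - (\<Sum>i\<in>F. ip x (e i) * ip (e i) y)) \<and>
       norm (ip x y - (\<Sum>i\<in>F. ip x (e i) * ip (e i) y))
         \<le> 1 / 4 * sqrt (\<Sum>i\<in>F. (norm (\<Phi> i - \<phi> i))\<^sup>2)
             * sqrt (\<Sum>i\<in>F. (norm (\<Gamma> i - \<gamma> i))\<^sup>2)
             - (\<Sum>i\<in>F. norm ((\<Phi> i + \<phi> i) / 2 - ip x (e i)) * norm ((\<Gamma> i + \<gamma> i) / 2 - ip y (e i))) \<and>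
       1 / 4 * sqrt (\<Sum>i\<in>F. (norm (\<Phi> i - \<phi> i))\<^sup>2)
         * sqrt (\<Sum>i\<in>F. (norm (\<Gamma> i - \<gamma> i))\<^sup>2)
         - (\<Sum>i\<in>F. norm ((\<Phi> i + \<phi> i) / 2 - ip x (e i)) * norm ((\<Gamma> i + \<gamma> i) / 2 - ip y (e i)))
         \<le> 1 / 4 * sqrt (\<Sum>i\<in>F. (norm (\<Phi> i - \<phi> i))\<^sup>2)
             * sqrt (\<Sum>i\<in>F. (norm (\<Gamma> i - \<gamma> i))\<^sup>2))) \<and>
   (\<forall>c::real. c < 1 / 4 \<longrightarrow>
      \<not> (\<forall>(scale :: 'k \<Rightarrow> 'k \<times> 'k \<Rightarrow> 'k \<times> 'k) ip (I :: nat set) e F \<phi> \<Phi> \<gamma> \<Gamma> x y.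
          inner_product_space scale ip \<and> orthonormal_family ip I e \<and> finite F \<and> F \<subseteq> I \<and>
          0 \<le> real_part (ip ((\<Sum>i\<in>F. scale (\<Phi> i) (e i)) - x) (x - (\<Sum>i\<in>F. scale (\<phi> i) (e i)))) \<and>
          0 \<le> real_part (ip ((\<Sum>i\<in>F. scale (\<Gamma> i) (e i)) - y) (y - (\<Sum>i\<in>F. scale (\<gamma> i) (e i)))) \<longrightarrow>
          norm (ip x y - (\<Sum>i\<in>F. ip x (e i) * ip (e i) y))
            \<le> c * sqrt (\<Sum>i\<in>F. (norm (\<Phi> i - \<phi> i))\<^sup>2)
                * sqrt (\<Sum>i\<in>F. (norm (\<Gamma> i - \<gamma> i))\<^sup>2)
                - (\<Sum>i\<in>F. norm ((\<Phi> i + \<phi> i) / 2 - ip x (e i)) * norm ((\<Gamma> i + \<gamma> i) / 2 - ip y (e i)))) \<and>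
      \<not> (\<forall>(scale :: 'k \<Rightarrow> 'k \<times> 'k \<Rightarrow> 'k \<times> 'k) ip (I :: nat set) e F \<phi> \<Phi> \<gamma> \<Gamma> x y.
          inner_product_space scale ip \<and> orthonormal_family ip I e \<and> finite F \<and> F \<subseteq> I \<and>
          0 \<le> real_part (ip ((\<Sum>i\<in>F. scale (\<Phi> i) (e i)) - x) (x - (\<Sum>i\<in>F. scale (\<phi> i) (e i)))) \<and>
          0 \<le> real_part (ip ((\<Sum>i\<in>F. scale (\<Gamma> i) (e i)) - y) (y - (\<Sum>i\<in>F. scale (\<gamma> i) (e i)))) \<longrightarrow>
          norm (ip x y - (\<Sum>i\<in>F. ip x (e i) * ip (e i) y))
            \<le> c * sqrt (\<Sum>i\<in>F. (norm (\<Phi> i - \<phi> i))\<^sup>2)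
                * sqrt (\<Sum>i\<in>F. (norm (\<Gamma> i - \<gamma> i))\<^sup>2)))"
proof (intro conjI allI impI, goal_cases)
  case (1 scale ip I e F \<phi> \<Phi> \<gamma> \<Gamma> x y)
  then interpret inner_product_space scale ip by blast
  show ?case
    using 1 real_part_bounds_iff_ball[of I e F \<Phi> x \<phi>] real_part_bounds_iff_ball[of I e F \<Gamma> y \<gamma>]
    by blast
next
  case 2
  show ?case by simp
next
  case (3 scale ip I e F \<phi> \<Phi> \<gamma> \<Gamma> x y)
  then interpret inner_product_space scale ip by blast
  have on: "orthonormal_family ip I e" "finite F" "F \<subseteq> I" using 3 by blast+
  have "ip_norm ip (x - (\<Sum>i\<in>F. scale ((\<Phi> i + \<phi> i) / 2) (e i)))
      \<le> 1 / 2 * sqrt (\<Sum>i\<in>F. (norm (\<Phi> i - \<phi> i))\<^sup>2)"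
    "ip_norm ip (y - (\<Sum>i\<in>F. scale ((\<Gamma> i + \<gamma> i) / 2) (e i)))
      \<le> 1 / 2 * sqrt (\<Sum>i\<in>F. (norm (\<Gamma> i - \<gamma> i))\<^sup>2)"
    \<comment> \<open>Whichever form of the hypothesis is given, it is brought to the ball
      form.\<close>
    using 3(2) real_part_bounds_iff_ball[OF on] by blast+
  from Gruss_inequality[OF on this] show ?case by simp
next
  case 4
  show ?case by (simp add: sum_nonneg)
next
  case (5 c)
  \<comment> \<open>At \<open>e = (1, 0)\<close>, bounds -1 and 1, and
    \<open>x = y = (0, 1)\<close>, both hypotheses hold with value 0. Midpoint and coefficient
    vanish, the left side is 1 and each root is 2, so the bound would read
    \<open>1 \<le> 4 * c\<close>.\<close>
  show ?case
    by (rule notI, drule spec[of _ pair_scale], drule spec[of _ pair_ip], drule spec[of _ "{0}"],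
        drule spec[of _ "\<lambda>_. (1, 0)"], drule spec[of _ "{0}"], drule spec[of _ "\<lambda>_. - 1"],
        drule spec[of _ "\<lambda>_. 1"], drule spec[of _ "\<lambda>_. - 1"], drule spec[of _ "\<lambda>_. 1"],
        drule spec[of _ "(0, 1)"], drule spec[of _ "(0, 1)"])
      (use 5 in \<open>simp add: inner_product_space_pair orthonormal_family_def pair_ip_def pair_scale_def\<close>)
next
  case (6 c)
  show ?case
    \<comment> \<open>The same witness serves, since the subtracted sum is 0 there.\<close>
    by (rule notI, drule spec[of _ pair_scale], drule spec[of _ pair_ip], drule spec[of _ "{0}"],
        drule spec[of _ "\<lambda>_. (1, 0)"], drule spec[of _ "{0}"], drule spec[of _ "\<lambda>_. - 1"],
        drule spec[of _ "\<lambda>_. 1"], drule spec[of _ "\<lambda>_. - 1"], drule spec[of _ "\<lambda>_. 1"],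
        drule spec[of _ "(0, 1)"], drule spec[of _ "(0, 1)"])
      (use 6 in \<open>simp add: inner_product_space_pair orthonormal_family_def pair_ip_def pair_scale_def\<close>)
qed

end
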